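(* If $A$ and $B$ are two finite image partition regular matrices of the same order, then for every finite coloring of $\mathbb{N}$ there exist vectors $\overrightarrow{X}, \overrightarrow{Y}$ such that $\{A\overrightarrow{X},\ A\overrightarrow{X}+B\overrightarrow{Y},\ A\overrightarrow{X}\cdot B\overrightarrow{Y}\}$ is monochromatic, where addition and multiplication of vectors are defined coordinate-wise.
   Context: $\mathbb{N}$ is the set of natural numbers. A finite coloring of $\mathbb{N}$ is a partition of $\mathbb{N}$ into finitely many disjoint pieces, and a set is called monochromatic if it is included in one piece of the partition. A matrix $A$ is said to be image partition regular if for any finite coloring of $\mathbb{N}$ there exists a vector $\overrightarrow{X}$ such that the entries of $A\overrightarrow{X}$ are monochromatic. A collection of vectors is called monochromatic when all entries of all the vectors in it lie in one and the same piece of the partition. Two matrices have the same order if they have the same number of rows and the same number of columns. *)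

theory Defs
  imports "HOL-Analysis.Cartesian_Space" "HOL-Library.Disjoint_Sets"
begin

text \<open>
  The set of natural numbers is the set of positive integers \<open>{1..} :: nat set\<close>: if 0 were
  included, the zero vector would make every matrix image partition regular.
  Matrices have rational entries; vectors witnessing image partition regularity have entries in
  the natural numbers, embedded into \<open>rat\<close> by \<open>of_nat\<close>.
\<close>

definition finite_coloring :: "nat set set \<Rightarrow> bool" where
  "finite_coloring P \<longleftrightarrow> finite P \<and> partition_on {1..} P"

definition monochromatic :: "nat set set \<Rightarrow> rat set \<Rightarrow> bool" where
  "monochromatic P S \<longleftrightarrow> (\<exists>C\<in>P. S \<subseteq> of_nat ` C)"

definition entries :: "'a ^ 'n \<Rightarrow> 'a set" where
  "entries x = range (\<lambda>i. x $ i)"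

definition natural_vector :: "rat ^ 'n \<Rightarrow> bool" where
  "natural_vector X \<longleftrightarrow> entries X \<subseteq> of_nat ` {1..}"

definition image_partition_regular :: "rat ^ 'n ^ 'm \<Rightarrow> bool" where
  "image_partition_regular A \<longleftrightarrow>
     (\<forall>P. finite_coloring P \<longrightarrow>
       (\<exists>X. natural_vector X \<and> monochromatic P (entries (A *v X))))"

definition monochromatic_vectors :: "nat set set \<Rightarrow> (rat ^ 'm) set \<Rightarrow> bool" where
  "monochromatic_vectors P V \<longleftrightarrow> monochromatic P (\<Union>w\<in>V. entries w)"

end

theory Submission
  imports Defs "HOL-Library.Nat_Bijection" "HOL-Analysis.Function_Topology"
begin

text \<open>
  The proof adapts Moreira's combinatorial argument for the pattern \<open>{x, x + y, x * y}\<close>, which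
  produces a sequence of large sets \<open>B\<^sub>0, B\<^sub>1, \<dots>\<close> and multipliers, and finds the pattern by the
  pigeonhole principle on the colors of these sets. Large means piecewise syndetic: this notion is
  partition regular, invariant under dilation, and, by van der Waerden's theorem, every large \<open>B\<close>
  contains a large set of starting points of progressions of any given length in \<open>B\<close> with a fixed
  difference (\<open>piecewise_syndetic_recurrence\<close>).

  Images of matrices enter as families of positive integer vectors, closed under scaling, that meet
  every finite coloring in a constant vector. Such a family cannot be sought inside an arbitrary
  large set: Schur's family \<open>(x, y, x + y)\<close> has no member with only odd entries. Instead, compactness
  replaces both families by finite subfamilies \<open>G\<close> and \<open>F\<close> such that for every scalar \<open>n\<close> some
  \<open>u \<in> G\<close> and \<open>v \<in> F\<close> make all products \<open>n * v l * u k\<close> equal in color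
  (\<open>partition_regular_families_product\<close>). Largeness then only concerns the scalar, and the
  vector \<open>u\<close> becomes part of the finite state to which the pigeonhole principle is applied.

  In step \<open>n\<close>, pass from \<open>B\<^sub>n\<close> to a large \<open>D\<^sub>n \<subseteq> B\<^sub>n\<close> on which the vectors \<open>u, v\<close> and the
  color \<open>c\<close> are constant, with \<open>x + i * y \<in> B\<^sub>n\<close> for all \<open>x \<in> D\<^sub>n\<close> and many \<open>i\<close>; then put
  \<open>B\<^sub>n\<^sub>+\<^sub>1 = q * D\<^sub>n\<close>, where \<open>q = M * y * v k0\<close> uses only one fixed coordinate of \<open>v\<close>. Thus the
  multipliers of the earlier steps are scalars, and only the vector \<open>v\<close> of the last step is used in
  full, so that their product with it is again a member of the second family.

  If the state \<open>(u, c)\<close> reached after step \<open>i\<close> recurs after step \<open>j > i\<close>, take \<open>x \<in> D\<^sub>j\<close>, let \<open>Q\<close> be the product of the multipliers of the steps in between,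
  and write \<open>x = Q * s\<close>. The required vectors are \<open>s * u\<close> and \<open>M * y * Q * v\<close>. Their product is
  \<open>x * (M * y * v) * u\<close>, of color \<open>c\<close> by the choice of \<open>D\<^sub>j\<close>. In their sum, \<open>u k\<close> divides \<open>M\<close>, so
  coordinate \<open>k\<close> is \<open>s' * u k\<close> with \<open>s' = s + (M div u k) * y * Q * v k\<close>, and \<open>Q * s'\<close> is \<open>x\<close> plus
  a bounded multiple of \<open>y\<close>; recurrence therefore puts \<open>s'\<close> back into \<open>B\<^sub>i\<^sub>+\<^sub>1\<close>, whose elements give
  color \<open>c\<close>.
\<close>

section \<open>Piecewise syndetic sets of natural numbers\<close>

text \<open>
  The usual definition asks that finitely many translates of \<open>B\<close> cover arbitrarily long intervals;
  here the translates are those by \<open>0, \<dots>, H\<close>.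
\<close>
definition piecewise_syndetic :: "nat set \<Rightarrow> bool" where
  "piecewise_syndetic B \<longleftrightarrow> (\<exists>H. \<forall>L. \<exists>a. \<forall>x<L. \<exists>h\<le>H. a + x + h \<in> B)"

lemma piecewise_syndetic_UNIV: "piecewise_syndetic UNIV"
  unfolding piecewise_syndetic_def by auto

lemma piecewise_syndetic_pos_element:
  assumes "piecewise_syndetic B"
  obtains x where "x \<in> B" "x > 0"
proof -
  obtain H where "\<forall>L. \<exists>a. \<forall>x<L. \<exists>h\<le>H. a + x + h \<in> B"
    using assms unfolding piecewise_syndetic_def by blast
  then obtain a where "\<forall>x<2. \<exists>h\<le>H. a + x + h \<in> B" by blast
  then have "\<exists>h\<le>H. a + 1 + h \<in> B" by (rule allE[of _ 1]) simp
  then obtain h where "a + 1 + h \<in> B" by blast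
  then show thesis using that by simp
qed

text \<open>
  If \<open>B\<close> is not piecewise syndetic, then every interval of some fixed length \<open>L0\<close> contains a point
  that no small translate of \<open>B\<close> covers. In a region covered by \<open>A \<union> B\<close> such points are covered by
  translates of \<open>A\<close>, and they are at most \<open>L0\<close> apart.
\<close>
lemma piecewise_syndetic_Un:
  assumes "piecewise_syndetic (A \<union> B)"
  shows "piecewise_syndetic A \<or> piecewise_syndetic B"
proof (rule disjCI)
  assume notB: "\<not> piecewise_syndetic B"
  obtain H where H: "\<And>L. \<exists>a. \<forall>x<L. \<exists>h\<le>H. a + x + h \<in> A \<union> B"
    using assms unfolding piecewise_syndetic_def by blast
  obtain L0 where L0: "\<And>a. \<exists>x<L0. \<forall>h\<le>H. a + x + h \<notin> B"
    using notB unfolding piecewise_syndetic_def by (simp only: not_ex not_all not_less) metis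
  have "\<exists>a. \<forall>x<L. \<exists>h\<le>L0 + H. a + x + h \<in> A" for L
  proof -
    obtain a where a: "\<And>x. x < L + L0 \<Longrightarrow> \<exists>h\<le>H. a + x + h \<in> A \<union> B" using H by blast
    have "\<exists>h\<le>L0 + H. a + x + h \<in> A" if "x < L" for x
    proof -
      obtain y where y: "y < L0" "\<forall>h\<le>H. a + x + y + h \<notin> B" using L0[of "a + x"] by auto
      have xy: "x + y < L + L0" using that y(1) by simp
      obtain h where h: "h \<le> H" "a + (x + y) + h \<in> A \<union> B"
        using a[of "x + y"] xy by blast
      then have "a + x + (y + h) \<in> A" using y(2) by (auto simp: add.assoc)
      then show ?thesis using y(1) h(1) by (intro exI[of _ "y + h"]) auto
    qed
    then show ?thesis by blast
  qed
  then show "piecewise_syndetic A" unfolding piecewise_syndetic_def by blast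
qed

lemma piecewise_syndetic_UN:
  assumes "finite I" "piecewise_syndetic (\<Union>i\<in>I. B i)"
  shows "\<exists>i\<in>I. piecewise_syndetic (B i)"
  using assms
proof (induction I rule: finite_induct)
  case empty
  then show ?case by (auto elim: piecewise_syndetic_pos_element)
next
  case (insert i I)
  then show ?case using piecewise_syndetic_Un[of "B i" "\<Union>i\<in>I. B i"] by auto
qed

lemma piecewise_syndetic_dilate:
  assumes "piecewise_syndetic B" "n > 0"
  shows "piecewise_syndetic ((*) n ` B)"
proof -
  obtain H where H: "\<And>L. \<exists>a. \<forall>x<L. \<exists>h\<le>H. a + x + h \<in> B"
    using assms unfolding piecewise_syndetic_def by blast
  have "\<exists>a. \<forall>x<L. \<exists>h\<le>n * H + n. a + x + h \<in> (*) n ` B" for L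
  proof -
    obtain a where a: "\<forall>x<L + 1. \<exists>h\<le>H. a + x + h \<in> B" using H by blast
    have "\<exists>h\<le>n * H + n. n * a + x + h \<in> (*) n ` B" if "x < L" for x
    proof -
      \<comment> \<open>\<open>n * q\<close> is the first multiple of \<open>n\<close> above \<open>x\<close>\<close>
      define q where "q = x div n + 1"
      have "x div n \<le> x" by simp
      then have "q < L + 1" using that unfolding q_def by linarith
      then obtain h where h: "h \<le> H" "a + q + h \<in> B" using a by blast
      have q1: "x = n * (x div n) + x mod n" and q2: "x mod n < n"
        using assms(2) by auto
      have q3: "n * q = n * (x div n) + n" unfolding q_def by (simp add: algebra_simps)
      have q: "x \<le> n * q" "n * q - x \<le> n" using q1 q2 q3 by linarith+
      have "n * a + x + (n * q - x + n * h) = n * (a + q + h)"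
        using q by (simp add: algebra_simps)
      then have "n * a + x + (n * q - x + n * h) \<in> (*) n ` B" using h(2) by (metis imageI)
      moreover have "n * q - x + n * h \<le> n * H + n"
        using q(2) h(1) by (metis add.commute add_mono mult_le_mono2)
      ultimately show ?thesis by blast
    qed
    then show ?thesis by blast
  qed
  then show ?thesis unfolding piecewise_syndetic_def by blast
qed

section \<open>Van der Waerden's theorem and recurrence\<close>

text \<open>
  The bound on \<open>d\<close> matters for \<open>k = 0\<close>, where \<open>a + k * d < W\<close> says nothing about the difference.
\<close>
definition mono_progression :: "nat \<Rightarrow> nat \<Rightarrow> (nat \<Rightarrow> nat) \<Rightarrow> bool" where
  "mono_progression k W f \<longleftrightarrow>
     (\<exists>a d. 0 < d \<and> d < W \<and> a + k * d < W \<and> (\<forall>i\<le>k. f (a + i * d) = f a))"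

text \<open>
  These are \<open>s\<close> progressions with \<open>k + 1\<close> terms, each constant in color and of different colors,
  that would all be extended to \<open>k + 2\<close> terms by the same point \<open>a\<close> in front of them.
\<close>
definition focused_progressions :: "nat \<Rightarrow> nat \<Rightarrow> nat \<Rightarrow> (nat \<Rightarrow> nat) \<Rightarrow> bool" where
  "focused_progressions k s W f \<longleftrightarrow>
     (\<exists>a d. a < W \<and> inj_on (\<lambda>j. f (a + d j)) {..<s} \<and>
        (\<forall>j<s. 0 < d j \<and> d j < W \<and> a + Suc k * d j < W \<and>
           (\<forall>i\<le>k. f (a + Suc i * d j) = f (a + d j))))"

lemma mono_progression_shift:
  assumes "mono_progression k w (\<lambda>x. f (n + x))" "n + w \<le> W"
  shows "mono_progression k W f"
proof -
  obtain a d where "0 < d" "d < w" "a + k * d < w" "\<forall>i\<le>k. f (n + (a + i * d)) = f (n + a)"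
    using assms(1) unfolding mono_progression_def by blast
  then show ?thesis using assms(2) unfolding mono_progression_def
    by (intro exI[of _ "n + a"] exI[of _ d]) (auto simp: add.assoc)
qed

text \<open>
  This is the color focusing step. Give \<open>n\<close> the coloring of the window of length \<open>w\<close> at \<open>n\<close> as its
  color, and find windows that look alike along a progression with difference \<open>e\<close>. The first of them
  contains \<open>s\<close> progressions focused at some \<open>a\<close>. Moving their terms diagonally through the windows,
  and repeating \<open>a\<close> itself in every window, gives \<open>s + 1\<close> progressions with the differences
  \<open>e + d j\<close> and \<open>e\<close>, focused at the copy of \<open>a\<close> one window earlier. The colors stay different unless
  \<open>a\<close> already completes one of the old progressions.
\<close>
lemma focused_progressions_extend:
  assumes w: "\<And>f. range f \<subseteq> S \<Longrightarrow> mono_progression (Suc k) w f \<or> focused_progressions k s w f"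
    and V: "\<And>f. range f \<subseteq> list_encode ` {xs. set xs \<subseteq> S \<and> length xs = w} \<Longrightarrow> mono_progression k V f"
    and f: "range f \<subseteq> S"
  shows "mono_progression (Suc k) (2 * V + w) f \<or> focused_progressions k (Suc s) (2 * V + w) f"
proof -
  \<comment> \<open>The offset \<open>V > e\<close> leaves room for the focus, which lies \<open>e\<close> before the first window.\<close>
  define g where "g n = list_encode (map (\<lambda>x. f (V + n + x)) [0..<w])" for n
  have "range g \<subseteq> list_encode ` {xs. set xs \<subseteq> S \<and> length xs = w}"
    using f unfolding g_def by (intro image_subsetI imageI) auto
  from V[OF this] obtain b e where be: "0 < e" "e < V" "b + k * e < V"
    "\<And>i. i \<le> k \<Longrightarrow> g (b + i * e) = g b"
    unfolding mono_progression_def by blast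
  have window: "f (V + b + i * e + x) = f (V + b + x)" if "i \<le> k" "x < w" for i x
  proof -
    have "map (\<lambda>x. f (V + (b + i * e) + x)) [0..<w] = map (\<lambda>x. f (V + b + x)) [0..<w]"
      using be(4)[OF that(1)] unfolding g_def list_encode_eq .
    then show ?thesis using that(2) by (auto simp: add.assoc)
  qed
  have "range (\<lambda>x. f (V + b + x)) \<subseteq> S" using f by auto
  from w[OF this] show ?thesis
  proof
    assume "mono_progression (Suc k) w (\<lambda>x. f (V + b + x))"
    then have "mono_progression (Suc k) (2 * V + w) f"
      by (rule mono_progression_shift) (use be in auto)
    then show ?thesis ..
  next
    assume "focused_progressions k s w (\<lambda>x. f (V + b + x))"
    then obtain a d where a: "a < w" and inj: "inj_on (\<lambda>j. f (V + b + (a + d j))) {..<s}"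
      and d: "\<And>j. j < s \<Longrightarrow> 0 < d j \<and> d j < w \<and> a + Suc k * d j < w"
      and foc: "\<And>j i. j < s \<Longrightarrow> i \<le> k \<Longrightarrow> f (V + b + (a + Suc i * d j)) = f (V + b + (a + d j))"
      unfolding focused_progressions_def by blast
    show ?thesis
    proof (cases "\<exists>j<s. f (V + b + (a + d j)) = f (V + b + a)")
      case True
      then obtain j where j: "j < s" "f (V + b + (a + d j)) = f (V + b + a)" by blast
      have "f (V + b + (a + i * d j)) = f (V + b + a)" if "i \<le> Suc k" for i
        using foc[OF j(1), of "i - 1"] j(2) that by (cases i) auto
      then have "mono_progression (Suc k) w (\<lambda>x. f (V + b + x))"
        unfolding mono_progression_def using d[OF j(1)]
        by (intro exI[of _ a] exI[of _ "d j"]) auto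
      then have "mono_progression (Suc k) (2 * V + w) f"
        by (rule mono_progression_shift) (use be in auto)
      then show ?thesis ..
    next
      case False
      define c where "c = V + b - e + a"
      define d' where "d' j = (if j < s then e + d j else e)" for j
      have c: "c + e = V + b + a" unfolding c_def using be by simp
      have c1: "c + (e + y) = V + b + (a + y)" for y using c by simp
      \<comment> \<open>The \<open>i\<close>-th point after the focus lies in the window number \<open>i\<close>, which agrees with the first one.\<close>
      have col: "f (c + Suc i * (e + y)) = f (V + b + (a + Suc i * y))"
        if "i \<le> k" "a + Suc i * y < w" for i y
      proof -
        have "c + Suc i * (e + y) = V + b + i * e + (a + Suc i * y)"
          using c by (simp add: algebra_simps)
        then show ?thesis by (simp only: window[OF that])
      qed
      have bound: "c + Suc k * (e + y) < 2 * V + w" if "a + Suc k * y < w" for y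
      proof -
        have "c + Suc k * (e + y) = V + (b + k * e) + (a + Suc k * y)"
          using c by (simp add: algebra_simps)
        then show ?thesis using be(3) that by linarith
      qed
      have le: "a + Suc i * d j < w" if "i \<le> k" "j < s" for i j
      proof -
        have "Suc i * d j \<le> Suc k * d j" using that by (intro mult_le_mono1) simp
        then show ?thesis using d[OF that(2)] by linarith
      qed
      have "inj_on (\<lambda>j. f (c + d' j)) {..<Suc s}"
      proof -
        have "inj_on (\<lambda>j. f (c + d' j)) {..<s}"
          using inj unfolding d'_def by (simp add: inj_on_def c1)
        moreover have "f (c + d' s) \<notin> (\<lambda>j. f (c + d' j)) ` {..<s}"
          using False unfolding d'_def by (auto simp: c1 c)
        ultimately show ?thesis by (simp add: lessThan_Suc)
      qed
      moreover have "0 < d' j \<and> d' j < 2 * V + w \<and> c + Suc k * d' j < 2 * V + w \<and>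
          (\<forall>i\<le>k. f (c + Suc i * d' j) = f (c + d' j))" if "j < Suc s" for j
      proof (cases "j < s")
        case True
        then show ?thesis
          using be d[OF True] bound[of "d j"] col[OF _ le] foc[OF True] unfolding d'_def
          by (auto simp: c1)
      next
        case False
        then show ?thesis using be a bound[of 0] col[of _ 0] unfolding d'_def by (auto simp: c)
      qed
      moreover have "c < 2 * V + w" unfolding c_def using be a by linarith
      ultimately have "focused_progressions k (Suc s) (2 * V + w) f"
        unfolding focused_progressions_def by blast
      then show ?thesis ..
    qed
  qed
qed

text \<open>
  Once there are as many focused progressions as colors, the color of the focus is that of one of
  them, which it extends by one term.
\<close>
theorem van_der_Waerden:
  assumes "finite S"
  shows "\<exists>W. \<forall>f. range f \<subseteq> S \<longrightarrow> mono_progression k W f"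
  using assms
proof (induction k arbitrary: S)
  case 0
  show ?case unfolding mono_progression_def
    by (intro exI[of _ 2] allI impI exI[of _ 0] exI[of _ 1]) auto
next
  case (Suc k)
  have step: "\<exists>W. \<forall>f. range f \<subseteq> S \<longrightarrow> mono_progression (Suc k) W f \<or> focused_progressions k s W f" for s
  proof (induction s)
    case 0
    show ?case unfolding focused_progressions_def by (intro exI[of _ 1]) auto
  next
    case (Suc s)
    then obtain w where w: "\<And>f. range f \<subseteq> S \<Longrightarrow>
        mono_progression (Suc k) w f \<or> focused_progressions k s w f" by blast
    have "finite (list_encode ` {xs. set xs \<subseteq> S \<and> length xs = w})"
      using finite_lists_length_eq[OF \<open>finite S\<close>] by blast
    from \<open>\<And>S. finite S \<Longrightarrow> \<exists>W. \<forall>f. range f \<subseteq> S \<longrightarrow> mono_progression k W f\<close>[OF this]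
    obtain V where V: "\<And>f. range f \<subseteq> list_encode ` {xs. set xs \<subseteq> S \<and> length xs = w} \<Longrightarrow>
        mono_progression k V f" by blast
    show ?case using focused_progressions_extend[OF w V] by blast
  qed
  obtain W where W: "\<And>f. range f \<subseteq> S \<Longrightarrow>
      mono_progression (Suc k) W f \<or> focused_progressions k (card S) W f"
    using step by blast
  have "mono_progression (Suc k) W f" if f: "range f \<subseteq> S" for f
    using W[OF f]
  proof
    assume "focused_progressions k (card S) W f"
    then obtain a d where inj: "inj_on (\<lambda>j. f (a + d j)) {..<card S}"
      and d: "\<And>j. j < card S \<Longrightarrow> 0 < d j \<and> d j < W \<and> a + Suc k * d j < W"
      and foc: "\<And>j i. j < card S \<Longrightarrow> i \<le> k \<Longrightarrow> f (a + Suc i * d j) = f (a + d j)"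
      unfolding focused_progressions_def by blast
    have "(\<lambda>j. f (a + d j)) ` {..<card S} = S"
      using f card_image[OF inj] by (intro card_subset_eq[OF \<open>finite S\<close>]) auto
    then have "f a \<in> (\<lambda>j. f (a + d j)) ` {..<card S}" using f by blast
    then obtain j where j: "j < card S" "f (a + d j) = f a" by (elim imageE) simp
    have "f (a + i * d j) = f a" if "i \<le> Suc k" for i
      using foc[OF j(1), of "i - 1"] j(2) that by (cases i) auto
    then show ?thesis using d[OF j(1)] unfolding mono_progression_def by blast
  qed
  then show ?case by blast
qed

text \<open>
  Color a point \<open>y\<close> of a region that is covered by translates of \<open>B\<close> by a shift \<open>h\<close> that takes it
  into \<open>B\<close>. A progression with constant color is moved into \<open>B\<close> by one shift. As the differences that
  van der Waerden's theorem provides are bounded, partition regularity selects one of them.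
\<close>
lemma piecewise_syndetic_recurrence:
  assumes "piecewise_syndetic B"
  shows "\<exists>d>0. piecewise_syndetic {x. \<forall>i\<le>k. x + i * d \<in> B}"
proof -
  obtain H where H: "\<And>L. \<exists>a. \<forall>x<L. \<exists>h\<le>H. a + x + h \<in> B"
    using assms unfolding piecewise_syndetic_def by blast
  obtain W where W: "\<And>f. range f \<subseteq> {..H} \<Longrightarrow> mono_progression k W f"
    using van_der_Waerden[of "{..H}" k] by blast
  let ?D = "\<lambda>d. {x. \<forall>i\<le>k. x + i * d \<in> B}"
  have "\<exists>a. \<forall>x<L. \<exists>h\<le>W + H. a + x + h \<in> (\<Union>d\<in>{0<..<W}. ?D d)" for L
  proof -
    obtain a where a: "\<And>x. x < L + W \<Longrightarrow> \<exists>h\<le>H. a + x + h \<in> B" using H by blast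
    have "\<exists>h\<le>W + H. a + x + h \<in> (\<Union>d\<in>{0<..<W}. ?D d)" if x: "x < L" for x
    proof -
      have "\<exists>h\<le>H. y < W \<longrightarrow> a + (x + y) + h \<in> B" for y
        using a[of "x + y"] x by (cases "y < W") auto
      then obtain f where f: "\<And>y. f y \<le> H" "\<And>y. y < W \<Longrightarrow> a + (x + y) + f y \<in> B" by metis
      obtain b d where bd: "0 < d" "d < W" "b + k * d < W" "\<And>i. i \<le> k \<Longrightarrow> f (b + i * d) = f b"
        using W[of f] f(1) unfolding mono_progression_def by blast
      have "a + x + (b + f b) + i * d \<in> B" if "i \<le> k" for i
      proof -
        have "i * d \<le> k * d" using that by simp
        then have "b + i * d < W" using bd(3) by linarith
        then have "a + (x + (b + i * d)) + f (b + i * d) \<in> B" by (rule f(2))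
        then show ?thesis unfolding bd(4)[OF that] by (simp add: ac_simps)
      qed
      then have "a + x + (b + f b) \<in> ?D d" by blast
      then have "a + x + (b + f b) \<in> (\<Union>d\<in>{0<..<W}. ?D d)"
        using bd(1,2) by (intro UN_I[of d]) auto
      moreover have "b + f b \<le> W + H" using bd(3) f(1)[of b] by linarith
      ultimately show ?thesis by blast
    qed
    then show ?thesis by blast
  qed
  then have "piecewise_syndetic (\<Union>d\<in>{0<..<W}. ?D d)"
    unfolding piecewise_syndetic_def by blast
  then show ?thesis using piecewise_syndetic_UN[of "{0<..<W}" ?D] by auto
qed

section \<open>Partition regular families of vectors\<close>

definition partition_regular_family :: "('m \<Rightarrow> nat) set \<Rightarrow> bool" where
  "partition_regular_family \<V> \<longleftrightarrow>
     (\<forall>f::nat \<Rightarrow> nat. finite (range f) \<longrightarrow> (\<exists>v\<in>\<V>. \<forall>k l. f (v k) = f (v l)))"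

text \<open>
  Finitely many vectors suffice for a given set of colors, since the space of all colorings is compact
  by Tychonoff's theorem and the colorings constant on a given vector form an open set.
\<close>
lemma partition_regular_family_compactness:
  fixes \<V> :: "('m::finite \<Rightarrow> nat) set" and S :: "'c set"
  assumes reg: "partition_regular_family \<V>" and S: "finite S"
  obtains F where "finite F" "F \<subseteq> \<V>"
    "\<And>f. range f \<subseteq> S \<Longrightarrow> \<exists>v\<in>F. \<forall>k l. f (v k) = f (v l)"
proof -
  define X where "X = product_topology (\<lambda>_::nat. discrete_topology S) UNIV"
  have top: "topspace X = {f. range f \<subseteq> S}" unfolding X_def by (auto simp: PiE_UNIV_domain)
  define U where "U v = {f \<in> topspace X. \<forall>k l. f (v k) = f (v l)}" for v :: "'m \<Rightarrow> nat"
  have "compact_space X" unfolding X_def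
    using S by (simp add: compact_space_product_topology compact_space_discrete_topology)
  moreover have "openin X (U v)" for v
  proof -
    have pre: "openin X {f \<in> topspace X. f (v k) \<in> {c}}" if "c \<in> S" for k c
    proof (rule openin_continuous_map_preimage)
      show "continuous_map X (discrete_topology S) (\<lambda>f. f (v k))"
        unfolding X_def by (rule continuous_map_product_projection) simp
    qed (use that in simp)
    have "U v = (\<Union>c\<in>S. \<Inter>k. {f \<in> topspace X. f (v k) \<in> {c}})"
      unfolding U_def top by (auto simp: image_subset_iff)
    moreover have "openin X (\<Union>c\<in>S. \<Inter>k. {f \<in> topspace X. f (v k) \<in> {c}})"
      using pre by (intro openin_clauses) (auto intro!: openin_Inter)
    ultimately show ?thesis by simp
  qed
  moreover have "topspace X \<subseteq> \<Union>(U ` \<V>)"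
  proof
    fix f assume f: "f \<in> topspace X"
    obtain j :: "'c \<Rightarrow> nat" where j: "inj_on j S" using S finite_imp_inj_to_nat_seg by metis
    have "finite (range (\<lambda>x. j (f x)))"
      using f unfolding top by (intro finite_subset[OF _ finite_imageI[OF S, of j]]) auto
    then obtain v where v: "v \<in> \<V>" "\<forall>k l. j (f (v k)) = j (f (v l))"
      using reg unfolding partition_regular_family_def by blast
    then have "f (v k) = f (v l)" for k l
      using f unfolding top by (intro inj_onD[OF j]) auto
    then have "f \<in> U v" using f unfolding U_def by simp
    then show "f \<in> \<Union>(U ` \<V>)" using v(1) by blast
  qed
  ultimately obtain \<F> where "finite \<F>" "\<F> \<subseteq> U ` \<V>" "topspace X \<subseteq> \<Union>\<F>"
    unfolding compact_space_alt by (metis (no_types, lifting) imageE)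
  then obtain F where "F \<subseteq> \<V>" "finite F" "topspace X \<subseteq> \<Union>(U ` F)"
    by (metis finite_subset_image)
  then show thesis using that[of F] unfolding top U_def by blast
qed

text \<open>
  Let \<open>E\<close> be the set of all entries of the finite family \<open>G\<close>. Coloring \<open>n\<close> by the pattern
  \<open>w \<mapsto> f (n * w)\<close> on \<open>E\<close> needs only finitely many colors, so \<open>F\<close> can be chosen before \<open>f\<close> and provides
  a \<open>v\<close> such that \<open>f (v l * w)\<close> depends on \<open>w\<close> alone. This dependence colors the members of \<open>E\<close>,
  and some \<open>u \<in> G\<close> is constant for it.
\<close>
lemma partition_regular_families_product:
  fixes \<U> :: "('m::finite \<Rightarrow> nat) set" and \<V> :: "('n::finite \<Rightarrow> nat) set" and S :: "'c set"
  assumes "partition_regular_family \<U>" "partition_regular_family \<V>" "finite S"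
  obtains G F where "finite G" "G \<subseteq> \<U>" "finite F" "F \<subseteq> \<V>"
    "\<And>f. range f \<subseteq> S \<Longrightarrow> \<exists>u\<in>G. \<exists>v\<in>F. \<exists>c. \<forall>k l. f (v l * u k) = c"
proof -
  obtain G where G: "finite G" "G \<subseteq> \<U>"
    "\<And>f. range f \<subseteq> S \<Longrightarrow> \<exists>u\<in>G. \<forall>k l. f (u k) = f (u l)"
    using partition_regular_family_compactness[OF assms(1,3)] by metis
  define E where "E = (\<Union>u\<in>G. range u)"
  have "finite E" unfolding E_def using G(1) by simp
  then have "finite (PiE E (\<lambda>_. S))" using assms(3) by (intro finite_PiE) auto
  then obtain F where F: "finite F" "F \<subseteq> \<V>"
    "\<And>f. range f \<subseteq> PiE E (\<lambda>_. S) \<Longrightarrow> \<exists>v\<in>F. \<forall>k l. f (v k) = f (v l)"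
    using partition_regular_family_compactness[OF assms(2)] by metis
  have "\<exists>u\<in>G. \<exists>v\<in>F. \<exists>c. \<forall>k l. f (v l * u k) = c" if f: "range f \<subseteq> S" for f
  proof -
    define g where "g n = restrict (\<lambda>w. f (n * w)) E" for n
    have "range g \<subseteq> PiE E (\<lambda>_. S)" using f unfolding g_def by auto
    then obtain v where v: "v \<in> F" "\<And>k l. g (v k) = g (v l)" using F(3) by blast
    define l0 :: 'n where "l0 = undefined"
    have v0: "f (v l * w) = f (v l0 * w)" if "w \<in> E" for l w
      using fun_cong[OF v(2)[of l l0], of w] that unfolding g_def by simp
    have "range (\<lambda>w. f (v l0 * w)) \<subseteq> S" using f by auto
    then obtain u where u: "u \<in> G" "\<And>k l. f (v l0 * u k) = f (v l0 * u l)" using G(3) by blast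
    have "f (v l * u k) = f (v l0 * u undefined)" for k l
      using v0[of "u k" l] u(2)[of k undefined] u(1) unfolding E_def by auto
    then show ?thesis using u(1) v(1) by blast
  qed
  then show thesis using that G(1,2) F(1,2) by blast
qed

section \<open>Sums and products of members of two families\<close>

text \<open>
  After the recurrence has fixed \<open>y\<close>, each scalar \<open>x\<close> admits one of the finitely many triples
  \<open>(u, v, c)\<close>, and partition regularity makes one triple work for a piecewise syndetic set of them.
\<close>
lemma recurrent_refinement:
  fixes \<phi> :: "nat \<Rightarrow> 'c"
  assumes B: "piecewise_syndetic B" and fin: "finite G" "finite F" "finite S" and chi: "range \<phi> \<subseteq> S"
    and GF: "\<And>f. range f \<subseteq> S \<Longrightarrow> \<exists>u\<in>G. \<exists>v\<in>F. \<exists>c. \<forall>k l. f (v l * u k) = c"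
  shows "\<exists>y u v c D. 0 < y \<and> u \<in> G \<and> v \<in> F \<and> c \<in> S \<and> piecewise_syndetic D \<and>
    (\<forall>x\<in>D. (\<forall>i\<le>K. x + i * y \<in> B) \<and> (\<forall>k l. \<phi> (x * (M * y * v l) * u k) = c))"
proof -
  obtain y where y: "y > 0" "piecewise_syndetic {x. \<forall>i\<le>K. x + i * y \<in> B}"
    using piecewise_syndetic_recurrence[OF B] by blast
  let ?D = "\<lambda>(u, v, c). {x. (\<forall>i\<le>K. x + i * y \<in> B) \<and> (\<forall>k l. \<phi> (x * (M * y * v l) * u k) = c)}"
  have "{x. \<forall>i\<le>K. x + i * y \<in> B} \<subseteq> (\<Union>z\<in>G \<times> F \<times> S. ?D z)"
  proof
    fix x assume x: "x \<in> {x. \<forall>i\<le>K. x + i * y \<in> B}"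
    have "range (\<lambda>n. \<phi> (x * (M * y) * n)) \<subseteq> S" using chi by auto
    then obtain u v c where uvc: "u \<in> G" "v \<in> F" "\<And>k l. \<phi> (x * (M * y) * (v l * u k)) = c"
      using GF by meson
    have "c \<in> S" using uvc(3) chi by (metis rangeI subsetD)
    moreover have "x \<in> ?D (u, v, c)" using x uvc(3) by (simp add: mult.assoc)
    ultimately show "x \<in> (\<Union>z\<in>G \<times> F \<times> S. ?D z)" using uvc(1,2) by blast
  qed
  then have "{x. \<forall>i\<le>K. x + i * y \<in> B} = (\<Union>z\<in>G \<times> F \<times> S. ?D z)" by auto
  then obtain u v c where "u \<in> G" "v \<in> F" "c \<in> S" "piecewise_syndetic (?D (u, v, c))"
    using piecewise_syndetic_UN[of "G \<times> F \<times> S" ?D] y(2) fin by auto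
  then show ?thesis using y(1)
    by (intro exI[of _ y] exI[of _ u] exI[of _ v] exI[of _ c] exI[of _ "?D (u, v, c)"]) auto
qed

text \<open>
  The sequence of sets described at the beginning is built here. Its terms are \<open>(B, P, u, c)\<close>, where
  \<open>P\<close> is the product of all multipliers so far; the vector and the color of the initial term are
  arbitrary, which is why only terms with a successor index are compared.
\<close>
theorem partition_regular_families_sum_product:
  fixes \<U> \<V> :: "('m::finite \<Rightarrow> nat) set" and \<phi> :: "nat \<Rightarrow> 'c"
  assumes reg: "partition_regular_family \<U>" "partition_regular_family \<V>"
    and pos: "\<And>u k. u \<in> \<U> \<Longrightarrow> 0 < u k" "\<And>v k. v \<in> \<V> \<Longrightarrow> 0 < v k"
    and S: "finite S" "range \<phi> \<subseteq> S"
  obtains u v s t c where "u \<in> \<U>" "v \<in> \<V>" "0 < s" "0 < t"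
    "\<And>k. \<phi> (s * u k) = c" "\<And>k. \<phi> (s * u k + t * v k) = c" "\<And>k. \<phi> ((s * u k) * (t * v k)) = c"
proof -
  obtain G F where G: "finite G" "G \<subseteq> \<U>" and F: "finite F" "F \<subseteq> \<V>"
    and GF: "\<And>f. range f \<subseteq> S \<Longrightarrow> \<exists>u\<in>G. \<exists>v\<in>F. \<exists>c. \<forall>k l. f (v l * u k) = c"
    using partition_regular_families_product[OF reg S(1)] by metis
  \<comment> \<open>\<open>M\<close> lets the entries of \<open>u\<close> be factored out of the sum; \<open>N\<close> bounds the entries of \<open>v\<close>.\<close>
  define M where "M = (\<Prod>u\<in>G. \<Prod>k\<in>UNIV. u k)"
  define N where "N = (\<Sum>v\<in>F. \<Sum>l\<in>UNIV. v l)"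
  have M0: "0 < M" unfolding M_def using G(2) pos(1) by (auto intro!: prod_pos)
  have M: "u k dvd M" if "u \<in> G" for u k
    unfolding M_def using that G(1)
    by (meson UNIV_I dvd_prodI dvd_trans finite)
  have N: "v l \<le> N" if "v \<in> F" for v l
  proof -
    have "v l \<le> (\<Sum>l\<in>UNIV. v l)" by (rule member_le_sum) auto
    also have "\<dots> \<le> N" unfolding N_def using that F(1) by (intro member_le_sum) auto
    finally show ?thesis .
  qed
  define k0 :: 'm where "k0 = undefined"

  \<comment> \<open>The sum needs multiples \<open>(M div u k) * Q * Q * v k\<close> of \<open>y\<close>, where \<open>Q\<close> divides \<open>P\<close>; this
    explains the length \<open>M * (P * P) * N\<close>, which covers every earlier set of the sequence at once.\<close>
  define link where "link B P B' P' u c y v D \<longleftrightarrow>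
      0 < y \<and> u \<in> G \<and> v \<in> F \<and> c \<in> S \<and> piecewise_syndetic D \<and>
      (\<forall>x\<in>D. (\<forall>i\<le>M * (P * P) * N. x + i * y \<in> B) \<and> (\<forall>k l. \<phi> (x * (M * y * v l) * u k) = c)) \<and>
      B' = (*) (M * y * v k0) ` D \<and> P' = P * (M * y * v k0)"
    for B P B' P' and u v :: "'m \<Rightarrow> nat" and c y D
  have "\<exists>\<sigma>. \<forall>n. (case \<sigma> n of (B, P, u, c) \<Rightarrow> piecewise_syndetic B \<and> 0 < P) \<and>
      (case (\<sigma> n, \<sigma> (Suc n)) of ((B, P, _), (B', P', u, c)) \<Rightarrow> \<exists>y v D. link B P B' P' u c y v D)"
    (is "\<exists>\<sigma>. \<forall>n. ?I (\<sigma> n) \<and> ?R (\<sigma> n) (\<sigma> (Suc n))")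
  proof (rule dependent_nat_choice[where P = "\<lambda>_. ?I" and Q = "\<lambda>_ x y. ?R x y"])
    have "?I (UNIV, 1, undefined, undefined)" using piecewise_syndetic_UNIV by simp
    then show "\<exists>x. ?I x" by blast
  next
    fix z :: "nat set \<times> nat \<times> ('m \<Rightarrow> nat) \<times> 'c" assume z: "?I z"
    obtain B P w e where z_eq: "z = (B, P, w, e)" by (cases z)
    then have BP: "piecewise_syndetic B" "0 < P" using z by auto
    obtain y u v c D where yD: "0 < y" "u \<in> G" "v \<in> F" "c \<in> S" "piecewise_syndetic D"
      "\<forall>x\<in>D. (\<forall>i\<le>M * (P * P) * N. x + i * y \<in> B) \<and> (\<forall>k l. \<phi> (x * (M * y * v l) * u k) = c)"
      using recurrent_refinement[OF BP(1) G(1) F(1) S, where K = "M * (P * P) * N" and M = M] GF by metis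
    define q where "q = M * y * v k0"
    have "0 < q" unfolding q_def using M0 yD(1,3) F(2) pos(2) by auto
    then have "?I ((*) q ` D, P * q, u, c)"
      using piecewise_syndetic_dilate[OF yD(5)] BP(2) by simp
    moreover have "link B P ((*) q ` D) (P * q) u c y v D"
      unfolding link_def q_def using yD by blast
    then have "?R z ((*) q ` D, P * q, u, c)" unfolding z_eq by auto
    ultimately show "\<exists>z'. ?I z' \<and> ?R z z'" by blast
  qed
  then obtain \<sigma> where "\<forall>n. ?I (\<sigma> n) \<and> ?R (\<sigma> n) (\<sigma> (Suc n))" ..
  then have \<sigma>: "?I (\<sigma> n)" "?R (\<sigma> n) (\<sigma> (Suc n))" for n by (simp_all only:)
  define B P u c where "B n = fst (\<sigma> n)" and "P n = fst (snd (\<sigma> n))"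
    and "u n = fst (snd (snd (\<sigma> n)))" and "c n = snd (snd (snd (\<sigma> n)))" for n
  have P0: "0 < P n" for n using \<sigma>(1)[of n] unfolding P_def by (auto split: prod.splits)
  have "\<exists>y v D. link (B n) (P n) (B (Suc n)) (P (Suc n)) (u (Suc n)) (c (Suc n)) y v D" for n
    using \<sigma>(2)[of n] unfolding B_def P_def u_def c_def by (auto split: prod.splits)
  then obtain y v D where L:
    "\<And>n. link (B n) (P n) (B (Suc n)) (P (Suc n)) (u (Suc n)) (c (Suc n)) (y n) (v n) (D n)"
    by metis
  note L = L[unfolded link_def]

  have nested: "\<exists>Q>0. P j = P i * Q \<and> B j \<subseteq> (*) Q ` B i" if "i \<le> j" for i j
    using that
  proof (induction j rule: dec_induct)
    case base
    show ?case by (intro exI[of _ 1]) auto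
  next
    case (step j)
    then obtain Q where Q: "Q > 0" "P j = P i * Q" "B j \<subseteq> (*) Q ` B i" by blast
    define q where "q = M * y j * v j k0"
    have "P (Suc j) = P j * q" "B (Suc j) = (*) q ` D j" using L[of j] unfolding q_def by blast+
    moreover have "D j \<subseteq> B j" using L[of j] by force
    ultimately have "P (Suc j) = P i * (Q * q)" "B (Suc j) \<subseteq> (*) (Q * q) ` B i"
      using Q(2,3) by (auto simp: image_iff subset_iff mult_ac) (metis)
    then show ?case using P0[of "Suc j"] by (intro exI[of _ "Q * q"]) auto
  qed

  have color: "\<phi> (s * u (Suc i) k) = c (Suc i)" if s: "s \<in> B (Suc i)" for s i k
  proof -
    have "s \<in> (*) (M * y i * v i k0) ` D i" using s L[of i] by blast
    then obtain x where x: "x \<in> D i" "s = M * y i * v i k0 * x" by blast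
    have "\<phi> (x * (M * y i * v i k0) * u (Suc i) k) = c (Suc i)" using L[of i] x(1) by blast
    then show ?thesis unfolding x(2) by (simp only: mult_ac)
  qed

  have "\<not> inj (\<lambda>n. (u (Suc n), c (Suc n)))"
  proof
    assume "inj (\<lambda>n. (u (Suc n), c (Suc n)))"
    moreover have "range (\<lambda>n. (u (Suc n), c (Suc n))) \<subseteq> G \<times> S" using L by auto
    ultimately have "finite (UNIV :: nat set)"
      using G(1) S(1) by (meson finite_SigmaI inj_on_finite)
    then show False by simp
  qed
  then obtain i j where ij: "i < j" "u (Suc i) = u (Suc j)" "c (Suc i) = c (Suc j)"
    unfolding inj_def by (metis linorder_neqE_nat prod.inject)
  obtain Q where Q: "Q > 0" "P j = P (Suc i) * Q" "B j \<subseteq> (*) Q ` B (Suc i)"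
    using nested[of "Suc i" j] ij(1) by auto
  obtain x where x: "x \<in> D j" "x > 0" using L[of j] piecewise_syndetic_pos_element by metis
  have xB: "x + i * y j \<in> B j" if "i \<le> M * (P j * P j) * N" for i using L[of j] x(1) that by blast
  obtain s where s: "s \<in> B (Suc i)" "x = Q * s" using xB[of 0] Q(3) by auto
  define t where "t = M * y j * Q"
  have yv: "0 < y j" "v j \<in> F" "u (Suc j) \<in> G" using L[of j] by blast+
  show thesis
  proof (rule that)
    show "u (Suc j) \<in> \<U>" "v j \<in> \<V>" using yv G(2) F(2) by blast+
    show "0 < s" "0 < t" unfolding t_def using x(2) s(2) M0 yv(1) Q(1) by auto
    fix k
    show "\<phi> (s * u (Suc j) k) = c (Suc j)" using color[OF s(1)] ij by simp
    obtain M' where M': "M = u (Suc j) k * M'" using M[OF yv(3)] by blast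
    have "x + (M' * (Q * Q) * v j k) * y j \<in> B j"
    proof (intro xB mult_le_mono N yv)
      show "M' \<le> M" using M' M0 by simp
      show "Q \<le> P j" "Q \<le> P j" using Q(2) P0[of j] by simp_all
    qed
    also have "x + (M' * (Q * Q) * v j k) * y j = Q * (s + M' * y j * Q * v j k)"
      unfolding s(2) by (simp add: algebra_simps)
    finally have "s + M' * y j * Q * v j k \<in> B (Suc i)" using Q(1,3) by auto
    from color[OF this, of k] have "\<phi> ((s + M' * y j * Q * v j k) * u (Suc j) k) = c (Suc j)"
      using ij by simp
    moreover have "(s + M' * y j * Q * v j k) * u (Suc j) k = s * u (Suc j) k + t * v j k"
      unfolding t_def M' by (simp add: algebra_simps)
    ultimately show "\<phi> (s * u (Suc j) k + t * v j k) = c (Suc j)" by simp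
    have "\<phi> (x * (M * y j * v j k) * u (Suc j) k) = c (Suc j)" using L[of j] x(1) by blast
    moreover have "x * (M * y j * v j k) * u (Suc j) k = (s * u (Suc j) k) * (t * v j k)"
      unfolding t_def s(2) by (simp add: mult_ac)
    ultimately show "\<phi> ((s * u (Suc j) k) * (t * v j k)) = c (Suc j)" by simp
  qed
qed

section \<open>Images of matrices\<close>

definition natural_images :: "rat ^ 'n ^ 'm \<Rightarrow> ('m \<Rightarrow> nat) set" where
  "natural_images A =
     {u. (\<forall>k. 0 < u k) \<and> (\<exists>X. natural_vector X \<and> (\<forall>k. (A *v X) $ k = of_nat (u k)))}"

lemma image_partition_regular_imp_family:
  assumes "image_partition_regular A"
  shows "partition_regular_family (natural_images A)"
  unfolding partition_regular_family_def
proof (intro allI impI)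
  fix f :: "nat \<Rightarrow> nat" assume f: "finite (range f)"
  define P where "P = (\<lambda>c. f -` {c} \<inter> {1..}) ` (f ` {1..})"
  have "finite P" unfolding P_def using f by (meson finite_imageI finite_subset image_mono subset_UNIV)
  moreover have "partition_on {1..} P"
    unfolding P_def by (intro partition_onI) (auto simp: disjnt_def)
  ultimately obtain X C where X: "natural_vector X" and C: "C \<in> P" "entries (A *v X) \<subseteq> of_nat ` C"
    using assms unfolding image_partition_regular_def finite_coloring_def monochromatic_def by meson
  have "\<forall>k. \<exists>n\<in>C. (A *v X) $ k = of_nat n" using C(2) unfolding entries_def by blast
  then obtain u where u: "\<And>k. u k \<in> C" "\<And>k. (A *v X) $ k = of_nat (u k)" by metis
  obtain c where c: "C = f -` {c} \<inter> {1..}" using C(1) unfolding P_def by blast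
  have "0 < u k" "f (u k) = c" for k using u(1)[of k] unfolding c by auto
  moreover from this have "u \<in> natural_images A" unfolding natural_images_def using X u(2) by blast
  ultimately show "\<exists>v\<in>natural_images A. \<forall>k l. f (v k) = f (v l)" by metis
qed

lemma natural_images_scaled:
  assumes "u \<in> natural_images A" "s > 0"
  obtains X where "natural_vector X" "\<And>k. (A *v X) $ k = of_nat (s * u k)"
proof -
  obtain X where X: "natural_vector X" "\<And>k. (A *v X) $ k = of_nat (u k)"
    using assms(1) unfolding natural_images_def by blast
  have "of_nat s * X $ k \<in> of_nat ` {1..}" for k
  proof -
    have "X $ k \<in> of_nat ` {1..}" using X(1) unfolding natural_vector_def entries_def by blast
    then obtain n where "n \<ge> 1" "X $ k = of_nat n" by auto
    then have "of_nat s * X $ k = of_nat (s * n)" "s * n \<in> {1..}" using assms(2) by auto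
    then show ?thesis by blast
  qed
  then have "natural_vector (of_nat s *s X)" unfolding natural_vector_def entries_def by auto
  moreover have "(A *v (of_nat s *s X)) $ k = of_nat (s * u k)" for k
    using X(2) by (simp add: vector_scalar_commute)
  ultimately show thesis using that by blast
qed

text \<open>
  The image of a matrix is closed under multiplication by positive integers, so the scalars \<open>s\<close> and
  \<open>t\<close> are absorbed into the vectors \<open>X\<close> and \<open>Y\<close>.
\<close>
theorem theorem1p3:
  fixes A B :: "rat ^ 'n ^ 'm"
  assumes "image_partition_regular A"
    and "image_partition_regular B"
  shows "\<forall>P. finite_coloring P \<longrightarrow>
    (\<exists>X Y. natural_vector X \<and> natural_vector Y \<and>
      monochromatic_vectors P {A *v X, A *v X + B *v Y, (A *v X) * (B *v Y)})"
proof (intro allI impI)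
  fix P assume "finite_coloring P"
  then have P: "finite P" "partition_on {1..} P" unfolding finite_coloring_def by auto
  \<comment> \<open>Each positive number is colored by its piece, and \<open>0\<close> receives the extra color \<open>{}\<close>.\<close>
  have "\<exists>C. (C \<in> P \<and> n \<in> C) \<or> (n = 0 \<and> C = {})" for n
    using partition_onD1[OF P(2)] by (cases "n = 0") auto
  then obtain \<phi> where chi: "\<And>n. (\<phi> n \<in> P \<and> n \<in> \<phi> n) \<or> (n = 0 \<and> \<phi> n = {})" by metis
  have img_pos: "0 < u k" if "u \<in> natural_images A'" for u k and A' :: "rat ^ 'n ^ 'm"
    using that unfolding natural_images_def by blast
  have ran: "range \<phi> \<subseteq> insert {} P" using chi by blast
  have fin: "finite (insert {} P)" using P(1) by simp
  obtain u v s t C where uv: "u \<in> natural_images A" "v \<in> natural_images B" "0 < s" "0 < t"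
    and C: "\<And>k. \<phi> (s * u k) = C" "\<And>k. \<phi> (s * u k + t * v k) = C" "\<And>k. \<phi> ((s * u k) * (t * v k)) = C"
    by (rule partition_regular_families_sum_product[OF assms[THEN image_partition_regular_imp_family]
          _ _ fin ran]) (auto dest: img_pos)
  have pos: "0 < s * u k" "0 < t * v k" for k using uv unfolding natural_images_def by auto
  have mem: "n \<in> C" "C \<in> P" if "\<phi> n = C" "n > 0" for n using chi[of n] that by auto
  obtain X where X: "natural_vector X" "\<And>k. (A *v X) $ k = of_nat (s * u k)"
    using natural_images_scaled[OF uv(1,3)] by blast
  obtain Y where Y: "natural_vector Y" "\<And>k. (B *v Y) $ k = of_nat (t * v k)"
    using natural_images_scaled[OF uv(2,4)] by blast
  have "(A *v X) $ k \<in> of_nat ` C" for k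
    unfolding X(2) using mem(1)[OF C(1)] pos by blast
  moreover have "(A *v X + B *v Y) $ k \<in> of_nat ` C" for k
    unfolding vector_add_component X(2) Y(2) of_nat_add[symmetric]
    using mem(1)[OF C(2)] pos by (intro imageI) simp
  moreover have "((A *v X) * (B *v Y)) $ k \<in> of_nat ` C" for k
    unfolding vector_mult_component X(2) Y(2) of_nat_mult[symmetric]
    using mem(1)[OF C(3)] pos by (intro imageI) simp
  moreover have "C \<in> P" using mem(2)[OF C(1)] pos by blast
  ultimately have "monochromatic_vectors P {A *v X, A *v X + B *v Y, (A *v X) * (B *v Y)}"
    unfolding monochromatic_vectors_def monochromatic_def entries_def
    by (intro bexI[of _ C]) auto
  then show "\<exists>X Y. natural_vector X \<and> natural_vector Y \<and>
      monochromatic_vectors P {A *v X, A *v X + B *v Y, (A *v X) * (B *v Y)}"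
    using X(1) Y(1) by blast
qed

end
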